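(* For all $k,v\in\mathbb{N}$ such that $k\le 2v$, $$f_{2v,k}=\sum_{j\ge0}\sum_{r\ge0}\binom{j}{r}\binom{v-j}{r}\binom{v-(j+r)}{k-(2j+r)}=\sum_{j\ge0}\frac{(k-2j+1)_j\,(v+j-k+1)_{k-2j}}{j!\,(k-2j)!},$$ where $f_{2v,k}$ is the number of order ideals of cardinality $k$ of the fence poset $\mathcal{Z}_{2v}$, and in the last sum a summand with $k-2j<0$ is read as $0$.
   Context: $\mathbb{N}$ contains $0$. The fence poset $\mathcal{Z}_n$ of order $n$ is the poset on $\{z_1,\dots,z_n\}$ whose cover relations are exactly $z_{2j-1}\triangleleft z_{2j}\triangleright z_{2j+1}$ for all $j\ge1$ (whenever the indices lie in $\{1,\dots,n\}$), so odd-indexed elements are minimal; $\mathcal{Z}_0$ is empty. An order ideal of a poset $P$ is a subset $I\subseteq P$ such that $y\in I$ and $z\le y$ imply $z\in I$. $f_{n,k}$ denotes the number of order ideals of $\mathcal{Z}_n$ with exactly $k$ elements (the $k$-th Whitney number of the distributive lattice of order ideals of $\mathcal{Z}_n$, whose rank function is cardinality). Rising factorial: $(a)_0=1$ and $(a)_m=\prod_{i=0}^{m-1}(a+i)$ for integers $m\ge1$. Conventions: $\binom{a}{b}=0$ unless $0\le b\le a$; $1/(m!)=0$ for negative integers $m$, so in the last sum a summand with $k-2j<0$ is $0$ and that sum effectively runs over $0\le j\le k/2$. *)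

theory Defs
  imports "HOL-Analysis.Analysis"
begin

text \<open>The element \<open>z\<^sub>i\<close> of the fence poset is encoded by its index \<open>i\<close>, so the carrier is
  \<open>{1..n}\<close>. A pair \<open>(x, y)\<close> in a relation means that \<open>x\<close> lies below \<open>y\<close>.\<close>

definition fence_cover :: "nat \<Rightarrow> nat rel" where
  "fence_cover n =
     ({(2 * j - 1, 2 * j) | j. j \<ge> 1} \<union> {(2 * j + 1, 2 * j) | j. j \<ge> 1}) \<inter> {1..n} \<times> {1..n}"

definition fence_order :: "nat \<Rightarrow> nat rel" where
  "fence_order n = (fence_cover n)\<^sup>* \<inter> {1..n} \<times> {1..n}"

definition order_ideal :: "'a set \<Rightarrow> 'a rel \<Rightarrow> 'a set \<Rightarrow> bool" where
  "order_ideal P r I \<longleftrightarrow> I \<subseteq> P \<and> (\<forall>y\<in>I. \<forall>z\<in>P. (z, y) \<in> r \<longrightarrow> z \<in> I)"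

definition fence_whitney :: "nat \<Rightarrow> nat \<Rightarrow> nat" where
  "fence_whitney n k = card {I. order_ideal {1..n} (fence_order n) I \<and> card I = k}"

text \<open>Integer arguments are needed because the arguments of the binomial coefficients may become
  negative; truncated subtraction would give them the wrong value.\<close>

definition int_binom :: "int \<Rightarrow> int \<Rightarrow> nat" where
  "int_binom a b = (if 0 \<le> b \<and> b \<le> a then nat a choose nat b else 0)"

text \<open>Consistency check: \<open>fence_order n\<close> is a partial order on \<open>{1..n}\<close>, and its cover relations are
  exactly \<open>fence_cover n\<close>.\<close>

lemma fence_cover_parity:
  assumes "(x, y) \<in> fence_cover n"
  shows "odd x" "even y" "x \<in> {1..n}" "y \<in> {1..n}"
  using assms by (auto simp: fence_cover_def)

lemma fence_cover_no_chain: "(x, y) \<in> fence_cover n \<Longrightarrow> (y, z) \<notin> fence_cover n"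
  using fence_cover_parity(1,2) by blast

lemma fence_order_iff:
  "(x, y) \<in> fence_order n \<longleftrightarrow> x \<in> {1..n} \<and> y \<in> {1..n} \<and> (x = y \<or> (x, y) \<in> fence_cover n)"
proof -
  have "x = y \<or> (x, y) \<in> fence_cover n" if "(x, y) \<in> (fence_cover n)\<^sup>*"
    using that by (induction rule: rtrancl_induct) (auto dest: fence_cover_no_chain)
  then show ?thesis by (auto simp: fence_order_def)
qed

lemma partial_order_on_fence_order: "partial_order_on {1..n} (fence_order n)"
proof -
  have "refl_on {1..n} (fence_order n)"
    by (auto simp: refl_on_def fence_order_iff)
  moreover have "trans (fence_order n)"
    unfolding trans_def fence_order_iff by (blast dest: fence_cover_no_chain)
  moreover have "antisym (fence_order n)"
    unfolding antisym_def fence_order_iff by (blast dest: fence_cover_no_chain)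
  moreover have "fence_order n \<subseteq> {1..n} \<times> {1..n}"
    by (auto simp: fence_order_def)
  ultimately show ?thesis
    by (simp add: partial_order_on_def preorder_on_def)
qed

lemma fence_cover_iff_covers:
  "(x, y) \<in> fence_cover n \<longleftrightarrow>
     (x, y) \<in> fence_order n \<and> x \<noteq> y \<and>
     (\<forall>z. (x, z) \<in> fence_order n \<and> (z, y) \<in> fence_order n \<longrightarrow> z = x \<or> z = y)"
  unfolding fence_order_iff
  using fence_cover_parity(3,4) by (blast dest: fence_cover_no_chain)

end

(* Split the ideals of a fence according to whether they contain its last element.  This gives a
   linear recurrence that interleaves even and odd orders.  Pascal's rule shows that
     sum_j C(k-j, j) C(v-j, k-2j)    and    sum_j C(k-j-1, j) C(v-j, k-2j)
   satisfy the same recurrence, so they are f_{2v,k} and f_{2v-1,k}.  The double sum collapses to the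
   first of them by C(n,r) C(n-r,m-r) = C(n,m) C(m,r) and Vandermonde's convolution; the rising
   factorials are the same binomial coefficients written out. *)

theory Submission
  imports Defs
begin

section \<open>Ideals of fences\<close>

text \<open>Only even indices have anything below them, namely their two neighbours. The left one
  always lies in the carrier, so only the right one carries a bound.\<close>

definition fence_ideals :: "nat \<Rightarrow> nat \<Rightarrow> nat set set" where
  "fence_ideals n k = {I. I \<subseteq> {1..n} \<and> card I = k \<and>
     (\<forall>j\<ge>1. 2 * j \<in> I \<longrightarrow> 2 * j - 1 \<in> I \<and> (2 * j + 1 \<le> n \<longrightarrow> 2 * j + 1 \<in> I))}"

text \<open>A fence has no chain of three elements, so its order is the reflexive closure of the
  covers, and closure under covers suffices.\<close>

lemma fence_whitney_eq_card: "fence_whitney n k = card (fence_ideals n k)"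
proof -
  have "order_ideal {1..n} (fence_order n) I \<longleftrightarrow> I \<subseteq> {1..n} \<and>
     (\<forall>j\<ge>1. 2 * j \<in> I \<longrightarrow> 2 * j - 1 \<in> I \<and> (2 * j + 1 \<le> n \<longrightarrow> 2 * j + 1 \<in> I))" (is "?L \<longleftrightarrow> ?R") for I
  proof
    assume L: ?L
    then have sub: "I \<subseteq> {1..n}" and
      down: "\<And>y z. y \<in> I \<Longrightarrow> z \<in> {1..n} \<Longrightarrow> (z, y) \<in> fence_cover n \<Longrightarrow> z \<in> I"
      by (auto simp: order_ideal_def fence_order_iff)
    have "2 * j - 1 \<in> I \<and> (2 * j + 1 \<le> n \<longrightarrow> 2 * j + 1 \<in> I)" if j: "j \<ge> 1" "2 * j \<in> I" for j
    proof -
      have le: "2 * j \<le> n" using sub j by auto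
      have "(2 * j - 1, 2 * j) \<in> fence_cover n"
        using j le by (auto simp: fence_cover_def)
      moreover have "(2 * j + 1, 2 * j) \<in> fence_cover n" if "2 * j + 1 \<le> n"
        using j le that by (auto simp: fence_cover_def)
      ultimately show ?thesis
        using down[OF j(2)] fence_cover_parity(3) by blast
    qed
    with sub show ?R by blast
  next
    assume R: ?R
    have "z \<in> I" if "y \<in> I" "(z, y) \<in> fence_cover n" for y z
      using that R by (auto simp: fence_cover_def)
    with R show ?L
      by (auto simp: order_ideal_def fence_order_iff)
  qed
  then show ?thesis
    by (simp add: fence_whitney_def fence_ideals_def conj_ac)
qed

lemma finite_fence_ideals: "finite (fence_ideals n k)"
  by (rule finite_subset[of _ "Pow {1..n}"]) (auto simp: fence_ideals_def)

lemma fence_ideals_0_right: "fence_ideals n 0 = {{}}"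
  by (auto simp: fence_ideals_def card_eq_0_iff dest: finite_subset)

lemma fence_whitney_0_right: "fence_whitney n 0 = 1"
  by (simp add: fence_whitney_eq_card fence_ideals_0_right)

lemma fence_whitney_0_left: "fence_whitney 0 (Suc k) = 0"
  by (auto simp: fence_whitney_eq_card fence_ideals_def)

section \<open>Ideals with and without the last element\<close>

text \<open>For \<open>v > 0\<close> the last element lies below \<open>2 * v\<close>, so an ideal
  avoiding the former avoids the latter too, and both drop out of the carrier.\<close>

lemma fence_ideals_lack_odd:
  "{I \<in> fence_ideals (2 * v + 1) k. 2 * v + 1 \<notin> I} = fence_ideals (2 * v - 1) k"
proof (intro equalityI subsetI)
  fix I assume "I \<in> {I \<in> fence_ideals (2 * v + 1) k. 2 * v + 1 \<notin> I}"
  then have sub: "I \<subseteq> {1..2 * v + 1}" and c: "card I = k" and last: "2 * v + 1 \<notin> I" and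
    down: "\<And>j. j \<ge> 1 \<Longrightarrow> 2 * j \<in> I \<Longrightarrow>
      2 * j - 1 \<in> I \<and> (2 * j + 1 \<le> 2 * v + 1 \<longrightarrow> 2 * j + 1 \<in> I)"
    by (auto simp: fence_ideals_def)
  have "2 * v \<notin> I"
    \<comment> \<open>For \<open>v = 0\<close> the index \<open>2 * v\<close> is 0, outside the
      carrier.\<close>
    using down[of v] last sub by (cases v) auto
  have "i \<in> {1..2 * v - 1}" if "i \<in> I" for i
  proof -
    have "i \<in> {1..2 * v + 1}" "i \<noteq> 2 * v + 1" "i \<noteq> 2 * v"
      using that sub last \<open>2 * v \<notin> I\<close> by auto
    then show ?thesis by auto
  qed
  then show "I \<in> fence_ideals (2 * v - 1) k"
    using c down by (auto simp: fence_ideals_def)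
next
  fix I assume I: "I \<in> fence_ideals (2 * v - 1) k"
  then have sub: "I \<subseteq> {1..2 * v - 1}" by (simp add: fence_ideals_def)
  \<comment> \<open>The shorter fence ends in an odd index, so each even member already has its
    right neighbour inside and the larger bound adds no condition.\<close>
  have "2 * j + 1 \<le> 2 * v - 1" if "2 * j \<in> I" for j
    using subsetD[OF sub that] by auto presburger
  with I sub show "I \<in> {I \<in> fence_ideals (2 * v + 1) k. 2 * v + 1 \<notin> I}"
    by (fastforce simp: fence_ideals_def)
qed

text \<open>The last element is minimal: deleting it only releases \<open>2 * v\<close> from its
  right-neighbour condition, and adding it back satisfies that condition.\<close>

lemma fence_ideals_contain_odd:
  "{I \<in> fence_ideals (2 * v + 1) (Suc k). 2 * v + 1 \<in> I} =
     insert (2 * v + 1) ` fence_ideals (2 * v) k"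
proof (intro equalityI subsetI)
  fix I assume "I \<in> {I \<in> fence_ideals (2 * v + 1) (Suc k). 2 * v + 1 \<in> I}"
  then have sub: "I \<subseteq> {1..2 * v + 1}" and c: "card I = Suc k" and last: "2 * v + 1 \<in> I" and
    down: "\<And>j. j \<ge> 1 \<Longrightarrow> 2 * j \<in> I \<Longrightarrow>
      2 * j - 1 \<in> I \<and> (2 * j + 1 \<le> 2 * v + 1 \<longrightarrow> 2 * j + 1 \<in> I)"
    by (auto simp: fence_ideals_def)
  have "I - {2 * v + 1} \<subseteq> {1..2 * v}"
    using sub by force
  moreover have "card (I - {2 * v + 1}) = k"
    using c last by simp
  moreover have "2 * j - 1 \<in> I - {2 * v + 1} \<and> (2 * j + 1 \<le> 2 * v \<longrightarrow> 2 * j + 1 \<in> I - {2 * v + 1})"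
    if "j \<ge> 1" "2 * j \<in> I - {2 * v + 1}" for j
    using down[of j] that sub by auto
  ultimately have "I - {2 * v + 1} \<in> fence_ideals (2 * v) k"
    by (auto simp: fence_ideals_def)
  with insert_Diff[OF last, symmetric] show "I \<in> insert (2 * v + 1) ` fence_ideals (2 * v) k"
    by (rule image_eqI)
next
  fix I assume "I \<in> insert (2 * v + 1) ` fence_ideals (2 * v) k"
  then obtain J where I: "I = insert (2 * v + 1) J" and sub: "J \<subseteq> {1..2 * v}" and c: "card J = k" and
    down: "\<And>j. j \<ge> 1 \<Longrightarrow> 2 * j \<in> J \<Longrightarrow>
      2 * j - 1 \<in> J \<and> (2 * j + 1 \<le> 2 * v \<longrightarrow> 2 * j + 1 \<in> J)"
    by (auto simp: fence_ideals_def)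
  have "finite J" "2 * v + 1 \<notin> J"
    using sub by (auto dest: finite_subset)
  then have "card I = Suc k" using c I by simp
  moreover have "2 * j - 1 \<in> I \<and> (2 * j + 1 \<le> 2 * v + 1 \<longrightarrow> 2 * j + 1 \<in> I)"
    if "j \<ge> 1" "2 * j \<in> I" for j
  proof -
    have "2 * j \<noteq> 2 * v + 1" by presburger
    with that I have "2 * j \<in> J" by auto
    from down[OF that(1) this] show ?thesis
      \<comment> \<open>For \<open>j = v\<close> the right neighbour is the inserted element; for
        smaller \<open>j\<close> it lies in \<open>J\<close>.\<close>
      unfolding I by (cases "j = v") auto
  qed
  ultimately show "I \<in> {I \<in> fence_ideals (2 * v + 1) (Suc k). 2 * v + 1 \<in> I}"
    using I sub by (auto simp: fence_ideals_def)
qed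

text \<open>The last element is maximal, so no other member forces it in.\<close>

lemma fence_ideals_lack_even:
  "{I \<in> fence_ideals (2 * v + 2) k. 2 * v + 2 \<notin> I} = fence_ideals (2 * v + 1) k"
proof (intro equalityI subsetI)
  fix I assume "I \<in> {I \<in> fence_ideals (2 * v + 2) k. 2 * v + 2 \<notin> I}"
  then have sub: "I \<subseteq> {1..2 * v + 2}" and last: "2 * v + 2 \<notin> I" and I: "I \<in> fence_ideals (2 * v + 2) k"
    by (auto simp: fence_ideals_def)
  have "i \<in> {1..2 * v + 1}" if "i \<in> I" for i
  proof -
    have "i \<in> {1..2 * v + 2}" "i \<noteq> 2 * v + 2"
      using that sub last by auto
    then show ?thesis by auto
  qed
  with I show "I \<in> fence_ideals (2 * v + 1) k"
    by (auto simp: fence_ideals_def)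
next
  fix I assume I: "I \<in> fence_ideals (2 * v + 1) k"
  then have sub: "I \<subseteq> {1..2 * v + 1}" by (simp add: fence_ideals_def)
  have "2 * j + 1 \<le> 2 * v + 1" if "2 * j \<in> I" for j
    using subsetD[OF sub that] by auto
  with I sub show "I \<in> {I \<in> fence_ideals (2 * v + 2) k. 2 * v + 2 \<notin> I}"
    by (fastforce simp: fence_ideals_def)
qed

text \<open>The last element is maximal with \<open>2 * v + 1\<close> as its only lower neighbour,
  so it can be added to an ideal exactly when that neighbour is present.\<close>

lemma fence_ideals_contain_even:
  "{I \<in> fence_ideals (2 * v + 2) (Suc k). 2 * v + 2 \<in> I} =
     insert (2 * v + 2) ` {I \<in> fence_ideals (2 * v + 1) k. 2 * v + 1 \<in> I}"
proof (intro equalityI subsetI)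
  fix I assume "I \<in> {I \<in> fence_ideals (2 * v + 2) (Suc k). 2 * v + 2 \<in> I}"
  then have sub: "I \<subseteq> {1..2 * v + 2}" and c: "card I = Suc k" and last: "2 * v + 2 \<in> I" and
    down: "\<And>j. j \<ge> 1 \<Longrightarrow> 2 * j \<in> I \<Longrightarrow>
      2 * j - 1 \<in> I \<and> (2 * j + 1 \<le> 2 * v + 2 \<longrightarrow> 2 * j + 1 \<in> I)"
    by (auto simp: fence_ideals_def)
  have "I - {2 * v + 2} \<subseteq> {1..2 * v + 1}"
    using sub by force
  moreover have "card (I - {2 * v + 2}) = k"
    using c last by simp
  moreover have "2 * j - 1 \<in> I - {2 * v + 2} \<and>
      (2 * j + 1 \<le> 2 * v + 1 \<longrightarrow> 2 * j + 1 \<in> I - {2 * v + 2})"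
    if "j \<ge> 1" "2 * j \<in> I - {2 * v + 2}" for j
  proof -
    have "2 * j - 1 \<noteq> 2 * v + 2" "2 * j + 1 \<noteq> 2 * v + 2"
      using that(1) by presburger+
    moreover have "2 * j + 1 \<le> 2 * v + 1 \<Longrightarrow> 2 * j + 1 \<le> 2 * v + 2" by simp
    ultimately show ?thesis using down[OF that(1)] that(2) by blast
  qed
  moreover have "2 * v + 1 \<in> I - {2 * v + 2}"
    using down[of "v + 1"] last by simp
  ultimately have "I - {2 * v + 2} \<in> {I \<in> fence_ideals (2 * v + 1) k. 2 * v + 1 \<in> I}"
    unfolding fence_ideals_def by blast
  with insert_Diff[OF last, symmetric]
  show "I \<in> insert (2 * v + 2) ` {I \<in> fence_ideals (2 * v + 1) k. 2 * v + 1 \<in> I}"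
    by (rule image_eqI)
next
  fix I assume "I \<in> insert (2 * v + 2) ` {I \<in> fence_ideals (2 * v + 1) k. 2 * v + 1 \<in> I}"
  then obtain J where I: "I = insert (2 * v + 2) J" and sub: "J \<subseteq> {1..2 * v + 1}" and
    c: "card J = k" and mem: "2 * v + 1 \<in> J" and
    down: "\<And>j. j \<ge> 1 \<Longrightarrow> 2 * j \<in> J \<Longrightarrow>
      2 * j - 1 \<in> J \<and> (2 * j + 1 \<le> 2 * v + 1 \<longrightarrow> 2 * j + 1 \<in> J)"
    by (auto simp: fence_ideals_def)
  have "finite J" "2 * v + 2 \<notin> J"
    using sub by (auto dest: finite_subset)
  then have "card I = Suc k" using c I by simp
  moreover have "2 * j - 1 \<in> I \<and> (2 * j + 1 \<le> 2 * v + 2 \<longrightarrow> 2 * j + 1 \<in> I)"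
    if "j \<ge> 1" "2 * j \<in> I" for j
  \<comment> \<open>For \<open>j = v + 1\<close> the even member is the inserted one: its left
    neighbour is \<open>2 * v + 1\<close>, and its right one lies beyond the fence.\<close>
  proof (cases "j = v + 1")
    case True
    then show ?thesis using mem I by auto
  next
    case False
    with that I have "2 * j \<in> J" by auto
    moreover from this have "2 * j \<le> 2 * v + 1" using sub by auto
    ultimately show ?thesis
      using down[OF that(1)] I by auto
  qed
  ultimately show "I \<in> {I \<in> fence_ideals (2 * v + 2) (Suc k). 2 * v + 2 \<in> I}"
    using I sub by (auto simp: fence_ideals_def)
qed

section \<open>Recurrences for the Whitney numbers\<close>

lemma card_insert_image:
  assumes "\<And>I. I \<in> F \<Longrightarrow> a \<notin> I"
  shows "card (insert a ` F) = card F"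
  using assms by (intro card_image inj_onI) (metis Diff_insert_absorb)

lemma card_fence_ideals_split:
  "card (fence_ideals n k) =
     card {I \<in> fence_ideals n k. a \<notin> I} + card {I \<in> fence_ideals n k. a \<in> I}"
  by (subst card_Un_disjoint[symmetric])
     (auto intro: arg_cong[where f = card] finite_subset[OF _ finite_fence_ideals])

lemma fence_ideals_not_mem: "I \<in> fence_ideals n k \<Longrightarrow> a > n \<Longrightarrow> a \<notin> I"
  by (auto simp: fence_ideals_def)

lemma card_fence_ideals_contain_odd:
  "card {I \<in> fence_ideals (2 * v + 1) (Suc k). 2 * v + 1 \<in> I} = fence_whitney (2 * v) k"
  unfolding fence_ideals_contain_odd fence_whitney_eq_card
  by (rule card_insert_image) (auto dest: fence_ideals_not_mem)

text \<open>For \<open>v = 0\<close> the truncated \<open>2 * v - 1\<close> denotes the empty fence, as it should.\<close>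

lemma fence_whitney_odd:
  "fence_whitney (2 * v + 1) (Suc k) = fence_whitney (2 * v) k + fence_whitney (2 * v - 1) (Suc k)"
  using card_fence_ideals_split[of "2 * v + 1" "Suc k" "2 * v + 1"]
  by (simp only: card_fence_ideals_contain_odd fence_ideals_lack_odd fence_whitney_eq_card)

text \<open>An ideal containing \<open>2 * v + 2\<close> also contains \<open>2 * v + 1\<close>.
  Removing both leaves an ideal of the fence of order \<open>2 * v\<close> with two elements fewer,
  which is impossible for \<open>k = 0\<close>.\<close>

lemma fence_whitney_even:
  "fence_whitney (2 * v + 2) (Suc k) =
     (if k = 0 then 0 else fence_whitney (2 * v) (k - 1)) + fence_whitney (2 * v + 1) (Suc k)"
proof -
  have "card {I \<in> fence_ideals (2 * v + 2) (Suc k). 2 * v + 2 \<in> I} =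
      card {I \<in> fence_ideals (2 * v + 1) k. 2 * v + 1 \<in> I}"
    unfolding fence_ideals_contain_even
    by (rule card_insert_image) (auto dest: fence_ideals_not_mem)
  also have "\<dots> = (if k = 0 then 0 else fence_whitney (2 * v) (k - 1))"
  proof (cases k)
    case 0
    then show ?thesis by (simp add: fence_ideals_0_right)
  next
    case (Suc l)
    then show ?thesis using card_fence_ideals_contain_odd[of v l] by simp
  qed
  finally show ?thesis
    using card_fence_ideals_split[of "2 * v + 2" "Suc k" "2 * v + 2"]
    by (simp only: fence_ideals_lack_even fence_whitney_eq_card)
qed

section \<open>Binomial sums\<close>

text \<open>The range keeps \<open>v - j\<close> free of truncation, and the guard does the same for
  \<open>k - 2 * j\<close>.\<close>

definition even_sum :: "nat \<Rightarrow> nat \<Rightarrow> nat" where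
  "even_sum v k =
     (\<Sum>j\<le>v. if 2 * j \<le> k then (k - j choose j) * (v - j choose (k - 2 * j)) else 0)"

text \<open>The truncated \<open>k - j - 1\<close> only matters for \<open>k = j = 0\<close>, where the summand is \<open>1\<close>.\<close>

definition odd_sum :: "nat \<Rightarrow> nat \<Rightarrow> nat" where
  "odd_sum v k =
     (\<Sum>j\<le>v. if 2 * j \<le> k then (k - j - 1 choose j) * (v - j choose (k - 2 * j)) else 0)"

text \<open>Pascal's rule is applied to the second factor; the first is already
  \<open>k - j choose j\<close>, as in \<open>even_sum v k\<close>.\<close>

lemma odd_sum_Suc: "odd_sum (Suc v) (Suc k) = even_sum v k + odd_sum v (Suc k)"
proof -
  let ?t = "\<lambda>w j. if 2 * j \<le> Suc k
    then (Suc k - j - 1 choose j) * (w - j choose (Suc k - 2 * j)) else 0"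
  \<comment> \<open>The second factor is \<open>0 choose (Suc k - 2 * Suc v)\<close>. It survives
    only for \<open>Suc k = 2 * Suc v\<close>, where the first factor is
    \<open>v choose Suc v\<close>.\<close>
  have last: "?t (Suc v) (Suc v) = 0"
    by (cases "2 * Suc v = Suc k") (auto simp: binomial_eq_0)
  have "?t (Suc v) j = (if 2 * j \<le> k then (k - j choose j) * (v - j choose (k - 2 * j)) else 0)
      + ?t v j" if "j \<le> v" for j
  proof (cases "2 * j \<le> k")
    case True
    then have "Suc k - 2 * j = Suc (k - 2 * j)" "Suc v - j = Suc (v - j)"
      using that by auto
    then show ?thesis using True by (simp add: algebra_simps)
  next
    \<comment> \<open>Either both guards fail, or \<open>2 * j = Suc k\<close> and the first factor
      is \<open>j - 1 choose j\<close>, which is 0.\<close>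
    case False
    then show ?thesis by (auto simp: binomial_eq_0)
  qed
  then have "(\<Sum>j\<le>v. ?t (Suc v) j) = even_sum v k + odd_sum v (Suc k)"
    unfolding even_sum_def odd_sum_def sum.distrib[symmetric] by (intro sum.cong) auto
  then show ?thesis
    using last unfolding odd_sum_def by (simp only: sum.atMost_Suc)
qed

text \<open>Here Pascal's rule splits the first factor, and an index shift turns one part into
  \<open>even_sum v (k - 1)\<close>.\<close>

lemma even_sum_Suc:
  "even_sum (Suc v) (Suc k) = (if k = 0 then 0 else even_sum v (k - 1)) + odd_sum (Suc v) (Suc k)"
proof -
  let ?e = "\<lambda>j. if 2 * j \<le> Suc k
    then (Suc k - j choose j) * (Suc v - j choose (Suc k - 2 * j)) else 0"
  let ?o = "\<lambda>j. if 2 * j \<le> Suc k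
    then (Suc k - j - 1 choose j) * (Suc v - j choose (Suc k - 2 * j)) else 0"
  let ?c = "\<lambda>j. if k \<noteq> 0 \<and> 2 * j \<le> k - 1
    then (k - 1 - j choose j) * (v - j choose (k - 1 - 2 * j)) else 0"
  have "?e (Suc j) = ?c j + ?o (Suc j)" for j
  proof (cases "2 * Suc j \<le> Suc k")
    case True
    have "Suc k - Suc j = Suc (k - 1 - j)" "Suc k - 2 * Suc j = k - 1 - 2 * j"
      using True by auto
    with True show ?thesis by (simp add: algebra_simps)
  qed auto
  \<comment> \<open>At index 0 both first factors are \<open>n choose 0\<close>, so nothing has to
    be split off.\<close>
  moreover have "?e 0 = ?o 0" by simp
  ultimately have "sum ?e {..Suc v} = sum ?c {..v} + sum ?o {..Suc v}"
    by (simp only: sum.atMost_Suc_shift sum.distrib ac_simps)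
  moreover have "sum ?c {..v} = (if k = 0 then 0 else even_sum v (k - 1))"
    by (simp add: even_sum_def cong: if_cong)
  ultimately show ?thesis
    by (simp add: even_sum_def odd_sum_def)
qed

lemma even_sum_0_right: "even_sum v 0 = 1"
proof -
  have "even_sum v 0 = (\<Sum>j\<le>v. if j = 0 then 1 else 0)"
    unfolding even_sum_def by (intro sum.cong) auto
  then show ?thesis by simp
qed

lemma odd_sum_0_right: "odd_sum v 0 = 1"
proof -
  have "odd_sum v 0 = (\<Sum>j\<le>v. if j = 0 then 1 else 0)"
    unfolding odd_sum_def by (intro sum.cong) auto
  then show ?thesis by simp
qed

text \<open>Both orders go through one induction: the odd value at \<open>Suc v\<close> comes first,
  since the even recurrence uses it.\<close>

lemma fence_whitney_eq_sums:
  "fence_whitney (2 * v) k = even_sum v k \<and> fence_whitney (2 * v - 1) k = odd_sum v k"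
proof (induction v arbitrary: k)
  case 0
  show ?case
    by (cases k) (simp_all add: fence_whitney_0_left fence_whitney_0_right even_sum_def odd_sum_def)
next
  case (Suc v)
  show ?case
  proof (cases k)
    case 0
    then show ?thesis
      by (simp add: fence_whitney_0_right even_sum_0_right odd_sum_0_right)
  next
    case k: (Suc l)
    have o: "fence_whitney (2 * v + 1) (Suc l) = odd_sum (Suc v) (Suc l)"
      unfolding fence_whitney_odd odd_sum_Suc using Suc.IH by simp
    have "fence_whitney (2 * v + 2) (Suc l) = even_sum (Suc v) (Suc l)"
      unfolding fence_whitney_even even_sum_Suc o using Suc.IH by simp
    with o k show ?thesis by simp
  qed
qed

section \<open>The two formulas\<close>

text \<open>Vandermonde's convolution after reflecting \<open>j choose r\<close> to
  \<open>j choose (j - r)\<close>.\<close>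

lemma sum_choose_mult_choose: "(\<Sum>r\<le>j. (j choose r) * (m choose r)) = (m + j) choose j"
proof -
  have "(\<Sum>r\<le>j. (j choose r) * (m choose r)) = (\<Sum>r\<le>j. (m choose r) * (j choose (j - r)))"
    by (intro sum.cong refl) (metis atMost_iff binomial_symmetric mult.commute)
  then show ?thesis by (simp add: vandermonde)
qed

text \<open>Trinomial revision; for \<open>m > n\<close> both sides vanish.\<close>

lemma choose_mult_choose_diff:
  assumes "r \<le> m"
  shows "(n choose r) * ((n - r) choose (m - r)) = (n choose m) * (m choose r)"
proof (cases "m \<le> n")
  case True
  then show ?thesis using choose_mult[of r m n] assms by simp
next
  case False
  then have "n < r \<or> n - r < m - r" by linarith
  with False show ?thesis by (auto simp: binomial_eq_0)
qed

text \<open>The rising factorial runs from \<open>a + 1\<close> up to \<open>a + m\<close>. If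
  \<open>a\<close> is negative, the hypothesis puts 0 among its factors, and the binomial vanishes
  as well.\<close>

lemma pochhammer_div_fact_eq_binomial:
  assumes "0 \<le> a + int m"
  shows "pochhammer (real_of_int (a + 1)) m / fact m = real (nat (a + int m) choose m)"
proof -
  have "real (nat (a + int m) choose m) = real (nat (a + int m)) gchoose m"
    by (simp add: binomial_gbinomial)
  also have "\<dots> = pochhammer (real_of_int (a + int m) - real m + 1) m / fact m"
    using assms by (simp add: gbinomial_pochhammer')
  finally show ?thesis by simp
qed

lemma suminf_eq_sum_atMost:
  fixes f :: "nat \<Rightarrow> real"
  assumes "\<And>j. j > n \<Longrightarrow> f j = 0"
  shows "(\<Sum>j. f j) = (\<Sum>j\<le>n. f j)"
  using assms by (intro suminf_finite) auto

text \<open>Trinomial revision pulls out \<open>v - j choose (k - 2 * j)\<close>, free of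
  \<open>r\<close>; Vandermonde sums the rest to \<open>k - j choose j\<close>.\<close>

lemma suminf_int_binom_eq:
  fixes k v j :: nat
  assumes "j \<le> v"
  shows "(\<Sum>r. real (int_binom (int j) (int r)) * real (int_binom (int v - int j) (int r))
            * real (int_binom (int v - (int j + int r)) (int k - (2 * int j + int r)))) =
    (if 2 * j \<le> k then real ((k - j choose j) * (v - j choose (k - 2 * j))) else 0)"
    (is "suminf ?f = _")
proof -
  have summand: "?f r = (if 2 * j \<le> k
      then real ((v - j choose (k - 2 * j)) * ((j choose r) * (k - 2 * j choose r))) else 0)" for r
  proof (cases "2 * j + r \<le> k \<and> j + r \<le> v")
    case True
    have eq: "int v - (int j + int r) = int (v - j - r)" "int v - int j = int (v - j)"
      "int k - (2 * int j + int r) = int (k - 2 * j - r)"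
      using True assms by (auto simp: of_nat_diff)
    have ib: "int_binom (int a) (int b) = a choose b" for a b
      by (auto simp: int_binom_def binomial_eq_0)
    have "r \<le> k - 2 * j" using True by linarith
    from choose_mult_choose_diff[OF this, of "v - j"]
    have "(j choose r) * (v - j choose r) * (v - j - r choose (k - 2 * j - r)) =
        (v - j choose (k - 2 * j)) * ((j choose r) * (k - 2 * j choose r))"
      by (simp only: ac_simps)
    moreover have "2 * j \<le> k" using True by linarith
    ultimately show ?thesis
      by (simp only: eq ib if_True flip: of_nat_mult)
  next
    \<comment> \<open>If \<open>2 * j + r > k\<close>, the last lower index on the left is negative,
      and on the right the guard fails or \<open>r > k - 2 * j\<close>. If \<open>r > v - j\<close>,
      the second factor on the left is 0, and on the right \<open>k - 2 * j\<close> exceeds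
      \<open>v - j\<close> or is below \<open>r\<close>.\<close>
    case False
    with assms show ?thesis
      by (cases "j + r \<le> v") (auto simp: int_binom_def binomial_eq_0 not_le)
  qed
  have "suminf ?f = (\<Sum>r\<le>j. ?f r)"
    by (rule suminf_eq_sum_atMost) (simp add: int_binom_def)
  also have "\<dots> = (if 2 * j \<le> k
      then real ((v - j choose (k - 2 * j)) * (\<Sum>r\<le>j. (j choose r) * (k - 2 * j choose r))) else 0)"
    unfolding summand by (simp add: sum_distrib_left)
  also have "\<dots> = (if 2 * j \<le> k then real ((k - j choose j) * (v - j choose (k - 2 * j))) else 0)"
    unfolding sum_choose_mult_choose by (simp add: mult.commute)
  finally show ?thesis .
qed

theorem theorem2p6:
  fixes k v :: nat
  assumes "k \<le> 2 * v"
  shows "real (fence_whitney (2 * v) k) =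
      (\<Sum>j. \<Sum>r. real (int_binom (int j) (int r))
              * real (int_binom (int v - int j) (int r))
              * real (int_binom (int v - (int j + int r)) (int k - (2 * int j + int r))))
    \<and> (\<Sum>j. \<Sum>r. real (int_binom (int j) (int r))
              * real (int_binom (int v - int j) (int r))
              * real (int_binom (int v - (int j + int r)) (int k - (2 * int j + int r)))) =
      (\<Sum>j. if 2 * j \<le> k
            then pochhammer (real_of_int (int k - 2 * int j + 1)) j
                 * pochhammer (real_of_int (int v + int j - int k + 1)) (k - 2 * j)
                 / (fact j * fact (k - 2 * j))
            else 0)"
    (is "_ = suminf ?g \<and> suminf ?g = suminf ?h")
proof -
  have even: "real (even_sum v k) =
      (\<Sum>j\<le>v. if 2 * j \<le> k then real ((k - j choose j) * (v - j choose (k - 2 * j))) else 0)"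
    unfolding even_sum_def of_nat_sum by (intro sum.cong) auto
  \<comment> \<open>For \<open>j > v\<close> the upper argument \<open>int v - int j\<close> is
    negative, so every inner summand is 0.\<close>
  have "suminf ?g = (\<Sum>j\<le>v. ?g j)"
    by (rule suminf_eq_sum_atMost) (simp add: int_binom_def)
  also have "\<dots> = real (even_sum v k)"
    unfolding even by (intro sum.cong) (simp_all only: suminf_int_binom_eq atMost_iff)
  finally have g: "suminf ?g = real (even_sum v k)" .
  have "?h j = (if 2 * j \<le> k then real ((k - j choose j) * (v - j choose (k - 2 * j))) else 0)"
    if "j \<le> v" for j
  proof (cases "2 * j \<le> k")
    case True
    have "pochhammer (real_of_int (int k - 2 * int j + 1)) j / fact j = real (k - j choose j)"
      using pochhammer_div_fact_eq_binomial[of "int k - 2 * int j" j] True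
      by (simp add: nat_diff_distrib)
    \<comment> \<open>The base \<open>v + j - k\<close> may be negative, but adding
      \<open>k - 2 * j\<close> gives \<open>v - j\<close>, which is not.\<close>
    moreover have "pochhammer (real_of_int (int v + int j - int k + 1)) (k - 2 * j) / fact (k - 2 * j)
        = real (v - j choose (k - 2 * j))"
      using pochhammer_div_fact_eq_binomial[of "int v + int j - int k" "k - 2 * j"] True that
      by (simp add: nat_diff_distrib)
    ultimately show ?thesis
      using True by (simp only: of_nat_mult if_True times_divide_times_eq[symmetric])
  qed simp
  then have "(\<Sum>j\<le>v. ?h j) = real (even_sum v k)"
    unfolding even by (intro sum.cong) (simp_all only: atMost_iff)
  \<comment> \<open>Here \<open>k \<le> 2 * v\<close> enters: for \<open>j > v\<close> it gives
    \<open>2 * j > k\<close>, so the guard fails.\<close>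
  moreover have "suminf ?h = (\<Sum>j\<le>v. ?h j)"
    using assms by (intro suminf_eq_sum_atMost) simp
  moreover have "real (fence_whitney (2 * v) k) = real (even_sum v k)"
    by (simp add: fence_whitney_eq_sums)
  ultimately show ?thesis
    using g by (simp only: simp_thms)
qed

end
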